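(* Let two reciprocal two-port elements have scattering matrices $\mathbf{S}_n = \begin{bmatrix} A_n & B_n \\ B_n & D_n \end{bmatrix}$, $n=1,2$, and let their inner ports be connected through an ideal isolator with scattering matrix $\mathbf{S}_{\mathrm{iso}} = \begin{bmatrix} 0 & 0 \\ 1 & 0 \end{bmatrix}$. Then the scattering matrix $\mathbf{\Phi}$ of the resulting two-element group is non-symmetric and is given by $$\mathbf{\Phi} = \begin{bmatrix} A_1 & 0 \\ B_1B_2 & A_2 \end{bmatrix}.$$
   Context: Each element $n$ is a two-port with an outer port (interacting with free space) and an inner port (connected to the isolator). It is characterized by a symmetric (reciprocal) $2\times 2$ impedance matrix $\mathbf{Z}_n$, and its scattering matrix is $\mathbf{S}_n = (\mathbf{Z}_n - Z_0\mathbf{I})(\mathbf{Z}_n+Z_0\mathbf{I})^{-1}$, where $Z_0$ is the free-space impedance; it is written $\mathbf{S}_n = \begin{bmatrix} A_n & B_n \\ B_n & D_n\end{bmatrix}$. Let $a_n, b_n$ be the waves incident on, respectively leaving, element $n$ at its outer port, and let $a_{n0}, b_{n0}$ be the waves incident on, respectively leaving, element $n$ at its inner port, so that $$\begin{bmatrix} b_n \\ b_{n0}\end{bmatrix} = \mathbf{S}_n \begin{bmatrix} a_n \\ a_{n0}\end{bmatrix},\qquad n=1,2.$$ The isolator receives $b_{10}, b_{20}$ at its ports 1, 2 and emits $a_{10}, a_{20}$: $[a_{10},a_{20}]^{\mathrm T} = \mathbf{S}_{\mathrm{iso}}\,[b_{10},b_{20}]^{\mathrm T}$, i.e. $a_{10}=0$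 and $a_{20}=b_{10}$. The scattering matrix $\mathbf{\Phi}$ of the group is the $2\times 2$ matrix relating the outer waves when these relations hold: $[b_1,b_2]^{\mathrm T} = \mathbf{\Phi}\,[a_1,a_2]^{\mathrm T}$. A matrix is non-symmetric if it differs from its transpose.
   Formalization: Non-symmetry of Φ is claimed only when B_1 and B_2 are both nonzero; if B_1B_2 = 0 (e.g. Z_1 = Z_2 = Z_0 I) Φ is diagonal, hence symmetric. The formula for Φ is proved without this condition. *)

theory Defs
  imports "HOL-Analysis.Analysis"
begin

text \<open>In every two-port below, index 1 is the outer port and index 2 the inner port.\<close>

definition scattering_matrix :: "real \<Rightarrow> complex^2^2 \<Rightarrow> complex^2^2" where
  "scattering_matrix Z0 Z =
     (Z - mat (of_real Z0)) ** matrix_inv (Z + mat (of_real Z0))"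

text \<open>Reciprocity of the impedance matrix carries over to the scattering matrix, so writing the
  latter with equal off-diagonal entries is no restriction.\<close>

lemma transpose_scattering_matrix:
  assumes "transpose Z = Z" and inv: "invertible (Z + mat (of_real Z0))"
  shows "transpose (scattering_matrix Z0 Z) = scattering_matrix Z0 Z"
proof -
  define P where "P = Z + mat (of_real Z0)"
  define M where "M = Z - mat (of_real Z0)"
  have tP: "transpose P = P" and tM: "transpose M = M"
    using assms(1) by (auto simp: P_def M_def transpose_def mat_def vec_eq_iff)
  have comm: "P ** M = M ** P"
    by (simp add: P_def M_def matrix_matrix_mult_def mat_def vec_eq_iff sum_2 forall_2
        algebra_simps)
  have P1: "P ** matrix_inv P = mat 1" and P2: "matrix_inv P ** P = mat 1"
    using someI_ex[OF inv[unfolded invertible_def]] by (auto simp: P_def matrix_inv_def)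
  have tI: "transpose (matrix_inv P) = matrix_inv P"
    by (metis P1 P2 matrix_mul_assoc matrix_mul_lid matrix_mul_rid matrix_transpose_mul tP
        transpose_mat)
  have "matrix_inv P ** M = M ** matrix_inv P"
    by (metis P1 P2 comm matrix_mul_assoc matrix_mul_lid matrix_mul_rid)
  then show ?thesis
    by (simp add: scattering_matrix_def matrix_transpose_mul tM tI flip: P_def M_def)
qed

text \<open>The components of \<open>a, b, a0, b0\<close> are indexed by the element number: \<open>a, b\<close> collect the
  waves incident on and leaving the elements at the outer ports, \<open>a0, b0\<close> those at the inner ports.\<close>

definition group_waves ::
  "complex^2^2 \<Rightarrow> complex^2^2 \<Rightarrow> complex^2^2 \<Rightarrow>
   complex^2 \<Rightarrow> complex^2 \<Rightarrow> complex^2 \<Rightarrow> complex^2 \<Rightarrow> bool" where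
  "group_waves S1 S2 S_con a b a0 b0 \<longleftrightarrow>
     vector [b$1, b0$1] = S1 *v vector [a$1, a0$1] \<and>
     vector [b$2, b0$2] = S2 *v vector [a$2, a0$2] \<and>
     a0 = S_con *v b0"

text \<open>The equivalence, rather than an implication from left to right, rules out connections whose
  wave relations cannot be solved for every excitation \<open>a\<close>, and makes \<open>\<Phi>\<close> unique.\<close>

definition is_group_scattering_matrix ::
  "complex^2^2 \<Rightarrow> complex^2^2 \<Rightarrow> complex^2^2 \<Rightarrow> complex^2^2 \<Rightarrow> bool" where
  "is_group_scattering_matrix S1 S2 S_con \<Phi> \<longleftrightarrow>
     (\<forall>a b. (\<exists>a0 b0. group_waves S1 S2 S_con a b a0 b0) \<longleftrightarrow> b = \<Phi> *v a)"

definition S_iso :: "complex^2^2" where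
  "S_iso = vector [vector [0, 0], vector [1, 0]]"

end

theory Submission
  imports Defs
begin

text \<open>The isolator breaks the feedback loop: nothing returns to the inner port of element 1,
  so it responds with \<open>A1 * a$1\<close> outside and sends \<open>B1 * a$1\<close> inward. That
  wave drives element 2, which adds \<open>B2 * B1 * a$1\<close> to its own reflection
  \<open>A2 * a$2\<close>. Hence forward substitution solves the wave relations for every excitation
  (\<open>group_waves_iso_iff\<close>). The two transmissions are one-way, so symmetry fails once
  \<open>B1 * B2\<close> is nonzero.\<close>

lemma is_group_scattering_matrix_unique:
  assumes "is_group_scattering_matrix S1 S2 S_con \<Phi>"
    and "is_group_scattering_matrix S1 S2 S_con \<Psi>"
  shows "\<Phi> = \<Psi>"
proof -
  \<comment> \<open>For \<open>b = \<Phi> *v a\<close> the first equivalence supplies inner waves,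
    and the second then forces \<open>b = \<Psi> *v a\<close>.\<close>
  have "\<Phi> *v a = \<Psi> *v a" for a
    using assms unfolding is_group_scattering_matrix_def by blast
  then show ?thesis
    by (simp add: matrix_eq)
qed

text \<open>Distinct off-diagonal letters expose the signal path: inward through \<open>C1\<close>,
  outward through \<open>B2\<close>. The wave \<open>b0$2\<close> is absorbed by the isolator, so
  \<open>D2\<close> never reaches \<open>b\<close>.\<close>

lemma group_waves_iso_iff:
  "group_waves (vector [vector [A1, B1], vector [C1, D1]])
     (vector [vector [A2, B2], vector [C2, D2]]) S_iso a b a0 b0 \<longleftrightarrow>
   a0 = vector [0, C1 * a$1] \<and> b0 = vector [C1 * a$1, C2 * a$2 + D2 * (C1 * a$1)] \<and>
   b = vector [A1 * a$1, A2 * a$2 + B2 * (C1 * a$1)]"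
  by (auto simp: group_waves_def S_iso_def vec_eq_iff forall_2 matrix_vector_mult_def sum_2)

text \<open>The inner waves are explicit functions of \<open>a\<close>, so the existential over them
  collapses to the formula for \<open>b\<close>.\<close>

lemma is_group_scattering_matrix_iso:
  "is_group_scattering_matrix (vector [vector [A1, B1], vector [C1, D1]])
     (vector [vector [A2, B2], vector [C2, D2]]) S_iso
     (vector [vector [A1, 0], vector [C1 * B2, A2]])"
proof -
  have "vector [vector [A1, 0], vector [C1 * B2, A2]] *v a =
      (vector [A1 * a$1, A2 * a$2 + B2 * (C1 * a$1)] :: complex^2)" for a :: "complex^2"
    by (simp add: vec_eq_iff forall_2 matrix_vector_mult_def sum_2 algebra_simps)
  then show ?thesis
    by (simp add: is_group_scattering_matrix_def group_waves_iso_iff)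
qed

theorem theorem1:
  fixes Z0 :: real
    and Z1 Z2 :: "complex^2^2"
    and A1 B1 D1 A2 B2 D2 :: complex
  assumes "Z0 > 0"
    and "transpose Z1 = Z1" and "transpose Z2 = Z2"
    and "invertible (Z1 + mat (of_real Z0))" and "invertible (Z2 + mat (of_real Z0))"
    and "scattering_matrix Z0 Z1 = vector [vector [A1, B1], vector [B1, D1]]"
    and "scattering_matrix Z0 Z2 = vector [vector [A2, B2], vector [B2, D2]]"
  shows "(\<exists>!\<Phi>. is_group_scattering_matrix (scattering_matrix Z0 Z1) (scattering_matrix Z0 Z2) S_iso \<Phi>) \<and>
    (\<forall>\<Phi>. is_group_scattering_matrix (scattering_matrix Z0 Z1) (scattering_matrix Z0 Z2) S_iso \<Phi> \<longrightarrow>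
       \<Phi> = vector [vector [A1, 0], vector [B1 * B2, A2]] \<and>
       (B1 \<noteq> 0 \<and> B2 \<noteq> 0 \<longrightarrow> transpose \<Phi> \<noteq> \<Phi>))"
proof -
  let ?\<Phi> = "vector [vector [A1, 0], vector [B1 * B2, A2]] :: complex^2^2"
  have group: "is_group_scattering_matrix (scattering_matrix Z0 Z1) (scattering_matrix Z0 Z2)
      S_iso ?\<Phi>"
    \<comment> \<open>Reciprocity enters as the instance \<open>C1 = B1\<close>,
      \<open>C2 = B2\<close>.\<close>
    unfolding assms(6,7) by (rule is_group_scattering_matrix_iso)
  moreover have "transpose ?\<Phi> \<noteq> ?\<Phi>" if "B1 \<noteq> 0 \<and> B2 \<noteq> 0"
    using that by (auto simp: transpose_def vec_eq_iff forall_2)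
  ultimately show ?thesis
    using is_group_scattering_matrix_unique[OF _ group] by blast
qed

end
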